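(* Let $h:\mathbb{R}\to\mathbb{R}$ and let $Y=(Y_t)_{t\in[0,1]}$ be a real-valued measurable stochastic process with continuous sample paths whose marginals $\mu_t=\mathrm{law}(Y_t)$, together with $h$, satisfy assumptions (1)–(6) listed in the context. Let $X^{opt}_t$ be the process associated with the marginals $\mu_t$ (defined in the context). Then $$E\Big(h\Big(\int_0^1X^{opt}_t\,dt\Big)\Big)\le E\Big(\int_0^1h(Y_t)\,dt\Big).$$
   Context: $F_t$ denotes the cumulative distribution function of $\mu_t$, and for $\lambda\in(0,1)$, $x_\lambda(t)=F_t^{-1}(\lambda)$. Assumptions: (1) $h$ is strictly convex and $C^2$. (2) Each $\mu_t$ is absolutely continuous with respect to Lebesgue measure. (3) The support of each $\mu_t$ is a (possibly unbounded) interval $\mathrm{spt}\,\mu_t=[a_t,b_t]$, where $a_t$ may be $-\infty$ and $b_t$ may be $+\infty$. (4) The path $t\mapsto\mu_t$ is weakly continuous. (5) The first moments and $h$-moments of $\mu_t$ exist and are integrable in $t$: $\int_0^1\big|\int_{\mathbb{R}}x\,d\mu_t(x)\big|dt<\infty$ and $\int_0^1\big|\int_{\mathbb{R}}h(x)\,d\mu_t(x)\big|dt<\infty$. (6) The Riemann sums $\frac1N\sum_{i=1}^N x_\lambda(\frac iN)$ converge to $\int_0^1 x_\lambda(t)\,dt$ as $N\to\infty$, uniformly in $\lambda$ on compact subsets of $(0,1)$. The process $X^{opt}$: the underlying probability space is $(0,1)$ with Lebesgue measure, and $X^{opt}_t(\lambda)=x_\lambda(t)$. *)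

theory Defs
  imports "HOL-Probability.Probability"
begin

definition strictly_convex :: "(real \<Rightarrow> real) \<Rightarrow> bool" where
  "strictly_convex f \<longleftrightarrow>
     (\<forall>x y u. x \<noteq> y \<longrightarrow> 0 < u \<longrightarrow> u < 1 \<longrightarrow>
        f ((1 - u) * x + u * y) < (1 - u) * f x + u * f y)"

definition twice_cont_diff :: "(real \<Rightarrow> real) \<Rightarrow> bool" where
  "twice_cont_diff f \<longleftrightarrow>
     (\<exists>f' f''. (\<forall>x. (f has_real_derivative f' x) (at x)) \<and>
               (\<forall>x. (f' has_real_derivative f'' x) (at x)) \<and>
               continuous_on UNIV f'')"

definition msupport :: "real measure \<Rightarrow> real set" where
  "msupport \<mu> = {x. \<forall>U. open U \<longrightarrow> x \<in> U \<longrightarrow> emeasure \<mu> U > 0}"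

definition weakly_continuous_path :: "(real \<Rightarrow> real measure) \<Rightarrow> bool" where
  "weakly_continuous_path \<mu> \<longleftrightarrow>
     (\<forall>f :: real \<Rightarrow> real. continuous_on UNIV f \<longrightarrow> bounded (range f) \<longrightarrow>
        continuous_on {0..1} (\<lambda>t. \<integral>x. f x \<partial>\<mu> t))"

text \<open>
  The level-\<open>\<lambda>\<close> quantile \<open>x\<^sub>\<lambda>(t)\<close> is the genuine inverse of the distribution function
  of \<open>\<mu> t\<close>. It is only meant for \<open>\<lambda>\<close> in \<open>(0,1)\<close> and for measures that are absolutely continuous
  with an interval as support; the distribution function then takes the value \<open>\<lambda>\<close> exactly once,
  so no choice is hidden in the Hilbert operator underlying \<open>inv\<close>.
\<close>

definition quantile :: "(real \<Rightarrow> real measure) \<Rightarrow> real \<Rightarrow> real \<Rightarrow> real" where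
  "quantile \<mu> l t = inv (cdf (\<mu> t)) l"

definition Opt_space :: "real measure" where
  "Opt_space = restrict_space lborel {0<..<1}"

definition X_opt :: "(real \<Rightarrow> real measure) \<Rightarrow> real \<Rightarrow> real \<Rightarrow> real" where
  "X_opt \<mu> t l = quantile \<mu> l t"

end

theory Submission
  imports Defs
begin

text \<open>
  Averaging over \<open>t \<in> [0,1]\<close> is integration against a probability measure, so Jensen's inequality
  gives \<open>h (\<integral> X_opt t l dt) \<le> \<integral> h (X_opt t l) dt\<close> for almost every \<open>l\<close>.  Since \<open>X_opt t\<close> and \<open>Y t\<close> have
  the same law \<open>\<mu> t\<close>, Fubini's theorem turns both \<open>\<integral>\<integral> h (X_opt t l) dt dl\<close> and \<open>E \<integral> h (Y t) dt\<close> into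
  \<open>\<integral>\<integral> h d\<mu> t dt\<close>.  The moment hypotheses only bound signed moments; Fubini is still applicable
  because a strictly convex \<open>h\<close> dominates \<open>c \<bar>x\<bar>\<close> up to an affine function.
\<close>

section \<open>Linear growth of strictly convex functions\<close>

lemma strictly_convex_imp_convex_on:
  assumes "strictly_convex h"
  shows "convex_on UNIV h"
proof (rule convex_onI)
  fix t x y :: real
  assume t: "0 < t" "t < 1"
  show "h ((1 - t) *\<^sub>R x + t *\<^sub>R y) \<le> (1 - t) * h x + t * h y"
  proof (cases "x = y")
    case True
    then show ?thesis
      by (simp add: algebra_simps)
  next
    case False
    then show ?thesis
      using assms t unfolding strictly_convex_def by (simp add: less_imp_le)
  qed
qed simp

text \<open>The chords of \<open>h\<close> over [-1,0] and [0,1] have slopes \<open>m < p\<close>,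
  and outside its interval the line through a chord lies below \<open>h\<close>. Tilting by the mean
  slope \<open>b = (p + m) / 2\<close> leaves growth at rate \<open>c = (p - m) / 2\<close> in both
  directions. This growth is what recovers absolute integrability from signed moments.\<close>

lemma strictly_convex_coercive:
  assumes "strictly_convex h"
  obtains a b c where "c > 0" "\<And>x. c * \<bar>x\<bar> \<le> h x - b * x - a"
proof -
  have conv: "h ((1 - u) * x + u * y) \<le> (1 - u) * h x + u * h y"
    if "0 \<le> u" "u \<le> 1" for x y u
    using convex_onD[OF strictly_convex_imp_convex_on[OF assms] that] by simp
  define p where "p = h 1 - h 0"
  define m where "m = h 0 - h (-1)"
  \<comment> \<open>Strictness enters only here, at the midpoint of -1 and 1; it is what makes
    \<open>c\<close> positive.\<close>
  have "h ((1 - 1/2) * (-1) + 1/2 * 1) < (1 - 1/2) * h (-1) + 1/2 * h 1"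
    using assms unfolding strictly_convex_def by (metis divide_less_eq_1_pos field_sum_of_halves
        half_gt_zero_iff less_add_same_cancel1 one_neq_neg_one zero_less_one)
  then have "m < p"
    by (simp add: p_def m_def)
  have far_right: "h 0 + p * x \<le> h x" if "1 \<le> x" for x
  proof -
    have "h 1 \<le> (1 - 1/x) * h 0 + 1/x * h x"
      using conv[of "1/x" 0 x] that by simp
    then show ?thesis
      using that by (simp add: p_def field_simps)
  qed
  have far_left: "h 0 + m * x \<le> h x" if "x \<le> -1" for x
  proof -
    define y where "y = - x"
    have "1 \<le> y" "x = - y"
      using that by (auto simp: y_def)
    moreover from this have "h (-1) \<le> (1 - 1/y) * h 0 + 1/y * h (- y)"
      using conv[of "1/y" 0 "- y"] by simp
    ultimately show ?thesis
      by (simp add: m_def field_simps)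
  qed
  \<comment> \<open>The chord over [-1,0] is prolonged past 0: the point 0 is a convex combination
    of -1 and \<open>x\<close> with weight \<open>1/y\<close> on \<open>x\<close>, where
    \<open>y\<close> is the distance from -1 to \<open>x\<close>.\<close>
  have right: "h 0 + m * x \<le> h x" if "0 \<le> x" for x
  proof -
    define y where "y = 1 + x"
    have y: "1 \<le> y" "y = 1 + x"
      using that by (auto simp: y_def)
    then have "(1 - 1/y) * (-1) + 1/y * x = 0"
      by (simp add: field_simps)
    then have "h 0 \<le> (1 - 1/y) * h (-1) + 1/y * h x"
      using conv[of "1/y" "-1" x] y(1) by simp
    then have "y * h 0 \<le> (y - 1) * h (-1) + h x"
      using y(1) by (simp add: field_simps)
    then show ?thesis
      by (simp add: y(2) m_def algebra_simps)
  qed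
  have left: "h 0 + p * x \<le> h x" if "x \<le> 0" for x
  proof -
    define y where "y = 1 - x"
    have y: "1 \<le> y" "y = 1 - x"
      using that by (auto simp: y_def)
    then have "(1 - 1/y) * 1 + 1/y * x = 0"
      by (simp add: field_simps)
    then have "h 0 \<le> (1 - 1/y) * h 1 + 1/y * h x"
      using conv[of "1/y" 1 x] y(1) by simp
    then have "y * h 0 \<le> (y - 1) * h 1 + h x"
      using y(1) by (simp add: field_simps)
    then show ?thesis
      by (simp add: y(2) p_def algebra_simps)
  qed
  define c where "c = (p - m) / 2"
  have pm: "p * x = (p + m) / 2 * x + c * x" "m * x = (p + m) / 2 * x - c * x" for x
    by (auto simp: c_def field_simps)
  show ?thesis
  \<comment> \<open>On [-1,1] the chord bounds give only \<open>- c * \<bar>x\<bar>\<close> above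
    \<open>h 0\<close> and the tilt; since \<open>c * \<bar>x\<bar> \<le> c\<close> there, lowering
    the offset by \<open>2 * c\<close> makes up the difference.\<close>
  proof (rule that[of c "(p + m) / 2" "h 0 - 2 * c"])
    show "c > 0"
      using \<open>m < p\<close> by (simp add: c_def)
    fix x :: real
    consider "1 \<le> x" | "0 \<le> x" "x \<le> 1" | "x \<le> 0" "-1 \<le> x" | "x \<le> -1"
      by linarith
    then show "c * \<bar>x\<bar> \<le> h x - (p + m) / 2 * x - (h 0 - 2 * c)"
    proof cases
      case 1
      then show ?thesis
        using far_right[OF 1] pm(1)[of x] \<open>c > 0\<close> 1 by simp
    next
      case 2
      then have "c * x \<le> c"
        using \<open>c > 0\<close> by simp
      then show ?thesis
        using right[OF 2(1)] pm(2)[of x] 2 by simp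
    next
      case 3
      then have "c * (-x) \<le> c"
        using \<open>c > 0\<close> by (subst mult_le_cancel_left2) auto
      then show ?thesis
        using left[OF 3(1)] pm(1)[of x] 3 by simp
    next
      case 4
      then show ?thesis
        using far_left[OF 4] pm(2)[of x] \<open>c > 0\<close> 4 by simp
    qed
  qed
qed

section \<open>Supports, and distribution functions of absolutely continuous laws\<close>

text \<open>A point outside the support has an open null neighbourhood, and the Lindelof property
  reduces the union of all open null sets to a countable one.\<close>

lemma emeasure_msupport_complement:
  assumes "sets \<nu> = sets borel"
  shows "emeasure \<nu> (- msupport \<nu>) = 0"
proof -
  define \<F> where "\<F> = {U. open U \<and> emeasure \<nu> U = 0}"
  obtain \<F>' where \<F>': "\<F>' \<subseteq> \<F>" "countable \<F>'" "\<Union>\<F>' = \<Union>\<F>"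
    using Lindelof[of \<F>] by (auto simp: \<F>_def)
  have "(\<Union>U\<in>\<F>'. U) \<in> null_sets \<nu>"
    using \<F>' assms by (intro null_sets_UN') (auto simp: \<F>_def null_sets_def)
  moreover have "- msupport \<nu> = \<Union>\<F>"
    by (auto simp: msupport_def \<F>_def not_less)
  ultimately show ?thesis
    using \<F>'(3) by (simp add: null_sets_def)
qed

context real_distribution
begin

lemma isCont_cdf_abs_cont:
  assumes "absolutely_continuous lborel M"
  shows "isCont (cdf M) x"
proof -
  have "{x} \<in> null_sets lborel"
    by (simp add: null_sets_def)
  then have "{x} \<in> null_sets M"
    using assms by (auto simp: absolutely_continuous_def)
  then show ?thesis
    by (simp add: isCont_cdf measure_eq_0_null_sets)
qed

text \<open>Without atoms the distribution function is continuous, so the intermediate value theorem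
  applies between its limits 0 and 1. A preimage must exist for \<open>inv\<close> in
  \<open>quantile\<close> to be meaningful.\<close>

lemma cdf_attains:
  assumes "absolutely_continuous lborel M" "0 < l" "l < 1"
  shows "\<exists>x. cdf M x = l"
proof -
  have "eventually (\<lambda>x. cdf M x < l) at_bot" "eventually (\<lambda>x. cdf M x > l) at_top"
    using order_tendstoD(2)[OF cdf_lim_at_bot] order_tendstoD(1)[OF cdf_lim_at_top_prob] assms
    by auto
  then obtain a b where ab: "cdf M a < l" "cdf M b > l"
    by (metis eventually_at_bot_linorder eventually_at_top_linorder order_refl)
  then have "a \<le> b"
    using cdf_nondecreasing[of b a] by linarith
  then show ?thesis
    using IVT'[of "cdf M" a l b] ab isCont_cdf_abs_cont[OF assms(1)]
    by (auto intro!: continuous_at_imp_continuous_on)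
qed

text \<open>If the distribution function were flat from \<open>x\<close> to \<open>y\<close>, the
  open interval between them would be null and so miss the support. The support being an interval,
  it would then lie entirely to one side of the gap, forcing the common level to be 0 or 1.\<close>

lemma cdf_inj:
  fixes a b :: ereal
  assumes supp: "msupport M = {x. a \<le> ereal x \<and> ereal x \<le> b}"
    and l: "0 < cdf M x" "cdf M x < 1" and eq: "cdf M x = cdf M y"
  shows "x = y"
proof -
  have *: False if "x < y" "0 < cdf M x" "cdf M x < 1" "cdf M x = cdf M y" for x y
  proof -
    have "emeasure M {x<..y} = 0"
      using cdf_diff_eq[OF \<open>x < y\<close>] that(4) by (simp add: emeasure_eq_measure)
    then have "emeasure M {x<..<y} = 0"
      using emeasure_mono[of "{x<..<y}" "{x<..y}" M] by (simp add: subset_eq)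
    then have gap: "z \<notin> msupport M" if "x < z" "z < y" for z
      unfolding msupport_def using that
      by (auto intro!: exI[of _ "{x<..<y}"])
    obtain z where z: "x < z" "z < y"
      using dense \<open>x < y\<close> by blast
    have null: "- msupport M \<in> null_sets M"
    proof
      show "- msupport M \<in> sets M"
        by (simp add: supp)
    qed (simp add: emeasure_msupport_complement)
    from gap[OF z] consider "ereal z < a" | "b < ereal z"
      by (auto simp: supp not_le)
    then show False
    proof cases
      case 1
      then have "{..x} \<subseteq> - msupport M"
        using z by (auto simp: supp) (metis ereal_less_eq(3) less_le_trans less_le_not_le
            order_trans less_imp_le)
      then have "{..x} \<in> null_sets M"
        by (rule null_sets_subset[OF null, rotated]) auto
      then show False
        using that(2) by (simp add: cdf_def measure_eq_0_null_sets)
    next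
      case 2
      then have "{y<..} \<subseteq> - msupport M"
        using z by (auto simp: supp) (metis ereal_less_eq(3) less_le_trans less_le_not_le
            order_trans less_imp_le)
      then have "{y<..} \<in> null_sets M"
        by (rule null_sets_subset[OF null, rotated]) auto
      then have "prob {y<..} = 0"
        by (simp add: measure_eq_0_null_sets)
      moreover have "prob (- {..y}) = 1 - prob {..y}"
        using prob_compl[of "{..y}"] by (simp add: Compl_eq_Diff_UNIV)
      moreover have "- {..y} = {y<..}"
        by auto
      ultimately show False
        using that(3,4) by (simp add: cdf_def)
    qed
  qed
  show ?thesis
    using *[of x y] *[of y x] l eq by (metis linorder_neqE_linordered_idom)
qed

end

section \<open>The quantile process: measurability and law\<close>

text \<open>This Galois connection replaces events about quantiles by comparisons with the
  distribution function; both the measurability and the law of \<open>X_opt\<close> rest on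
  it.\<close>

lemma quantile_le_iff:
  fixes a b :: ereal
  assumes "real_distribution (\<mu> t)" "absolutely_continuous lborel (\<mu> t)"
    and supp: "msupport (\<mu> t) = {x. a \<le> ereal x \<and> ereal x \<le> b}"
    and l: "0 < l" "l < 1"
  shows "quantile \<mu> l t \<le> x \<longleftrightarrow> l \<le> cdf (\<mu> t) x"
proof -
  interpret real_distribution "\<mu> t" by fact
  have q: "cdf (\<mu> t) (quantile \<mu> l t) = l"
    unfolding quantile_def using cdf_attains[OF assms(2) l] by (metis f_inv_into_f rangeI)
  show ?thesis
  proof
    assume "quantile \<mu> l t \<le> x"
    then show "l \<le> cdf (\<mu> t) x"
      using cdf_nondecreasing q by metis
  next
    assume "l \<le> cdf (\<mu> t) x"
    \<comment> \<open>At equal levels monotonicity does not order the two points; injectivity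
      identifies them.\<close>
    then consider "l = cdf (\<mu> t) x" | "cdf (\<mu> t) (quantile \<mu> l t) < cdf (\<mu> t) x"
      using q by linarith
    then show "quantile \<mu> l t \<le> x"
    proof cases
      case 1
      then show ?thesis
        using cdf_inj[OF supp, of "quantile \<mu> l t" x] q l by simp
    next
      case 2
      then show ?thesis
        using cdf_nondecreasing[of x "quantile \<mu> l t"] by linarith
    qed
  qed
qed

lemma prob_space_restrict_lborel_Icc: "prob_space (restrict_space lborel {0..1::real})"
  by (rule prob_spaceI) (simp add: space_restrict_space emeasure_restrict_space)

lemma space_Opt_space [simp]: "space Opt_space = {0<..<1}"
  by (simp add: Opt_space_def space_restrict_space)

lemma prob_space_Opt_space: "prob_space Opt_space"
  by (rule prob_spaceI) (simp add: Opt_space_def space_restrict_space emeasure_restrict_space)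

text \<open>By the Galois connection each sublevel set is the region
  \<open>l \<le> cdf (\<mu> t) x\<close>, so joint measurability reduces to measurability in
  \<open>t\<close> of the distribution function at a fixed point.\<close>

lemma measurable_X_opt:
  assumes distr: "\<And>t. t \<in> space U \<Longrightarrow> real_distribution (\<mu> t)"
    and ac: "\<And>t. t \<in> space U \<Longrightarrow> absolutely_continuous lborel (\<mu> t)"
    and supp: "\<And>t. t \<in> space U \<Longrightarrow>
      \<exists>a b :: ereal. msupport (\<mu> t) = {x. a \<le> ereal x \<and> ereal x \<le> b}"
    and cdf: "\<And>x. (\<lambda>t. cdf (\<mu> t) x) \<in> borel_measurable U"
  shows "(\<lambda>(t, l). X_opt \<mu> t l) \<in> borel_measurable (U \<Otimes>\<^sub>M Opt_space)"
proof (unfold borel_measurable_iff_le, intro allI)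
  fix x :: real
  have [measurable]: "(\<lambda>l. l) \<in> borel_measurable Opt_space"
    unfolding Opt_space_def by (rule measurable_restrict_space1) simp
  note cdf[measurable]
  have "{w \<in> space (U \<Otimes>\<^sub>M Opt_space). (case w of (t, l) \<Rightarrow> X_opt \<mu> t l) \<le> x} =
        {w \<in> space (U \<Otimes>\<^sub>M Opt_space). snd w \<le> cdf (\<mu> (fst w)) x}"
    using quantile_le_iff distr ac supp
    by (fastforce simp: space_pair_measure X_opt_def)
  also have "\<dots> \<in> sets (U \<Otimes>\<^sub>M Opt_space)"
  proof -
    \<comment> \<open>The second factor carries the trace sigma-algebra on (0,1), so the projection
      is composed with the inclusion into the reals.\<close>
    have [measurable]: "(\<lambda>w. snd w) \<in> borel_measurable (U \<Otimes>\<^sub>M Opt_space)"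
      using measurable_compose[OF measurable_snd, of "\<lambda>l. l" Opt_space borel U] by simp
    show ?thesis by measurable
  qed
  finally show "{w \<in> space (U \<Otimes>\<^sub>M Opt_space). (case w of (t, l) \<Rightarrow> X_opt \<mu> t l) \<le> x}
      \<in> sets (U \<Otimes>\<^sub>M Opt_space)" .
qed

text \<open>Inverse transform sampling: the levels whose quantile is at most \<open>x\<close> form
  an interval starting at 0 of length \<open>cdf (\<mu> t) x\<close>, and the distribution function
  determines the law.\<close>

lemma distr_X_opt:
  fixes a b :: ereal
  assumes distr: "real_distribution (\<mu> t)"
    and ac: "absolutely_continuous lborel (\<mu> t)"
    and supp: "msupport (\<mu> t) = {x. a \<le> ereal x \<and> ereal x \<le> b}"
    and meas: "X_opt \<mu> t \<in> borel_measurable Opt_space"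
  shows "distr Opt_space borel (X_opt \<mu> t) = \<mu> t"
proof (rule cdf_unique)
  interpret real_distribution "\<mu> t" by fact
  interpret O: prob_space Opt_space by (rule prob_space_Opt_space)
  show "real_distribution (distr Opt_space borel (X_opt \<mu> t))"
    using O.real_distribution_distr[OF meas] .
  show "cdf (distr Opt_space borel (X_opt \<mu> t)) = cdf (\<mu> t)"
  proof
    fix x
    have F: "0 \<le> cdf (\<mu> t) x" "cdf (\<mu> t) x \<le> 1"
      by (auto simp: cdf_nonneg cdf_bounded_prob)
    have "cdf (distr Opt_space borel (X_opt \<mu> t)) x =
        measure Opt_space (X_opt \<mu> t -` {..x} \<inter> space Opt_space)"
      unfolding cdf_def using meas by (simp add: measure_distr)
    also have "X_opt \<mu> t -` {..x} \<inter> space Opt_space = {0<..cdf (\<mu> t) x} \<inter> {0<..<1}"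
      using quantile_le_iff[where \<mu> = \<mu> and t = t, OF distr ac supp] by (auto simp: X_opt_def)
    also have "measure Opt_space \<dots> = measure lborel ({0<..cdf (\<mu> t) x} \<inter> {0<..<1})"
      unfolding Opt_space_def by (rule measure_restrict_space) auto
    also have "\<dots> = cdf (\<mu> t) x"
    \<comment> \<open>The level 1 lies outside the sample space, so at the value 1 the interval is
      open instead of half-open, with the same length.\<close>
    proof (cases "cdf (\<mu> t) x = 1")
      case True
      then have "{0<..cdf (\<mu> t) x} \<inter> {0<..<1} = {0<..<1}"
        by auto
      with True show ?thesis
        by simp
    next
      case False
      then have "{0<..cdf (\<mu> t) x} \<inter> {0<..<1} = {0<..cdf (\<mu> t) x}"
        using F by auto
      with F show ?thesis
        by simp
    qed
    finally show "cdf (distr Opt_space borel (X_opt \<mu> t)) x = cdf (\<mu> t) x" .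
  qed
qed fact

section \<open>Fubini and Jensen for a process with prescribed marginals\<close>

text \<open>Formulated for an arbitrary process \<open>Z\<close>, so that it serves both
  \<open>Y\<close> and \<open>X_opt\<close>: the value of the double integral depends on the
  marginals alone. Tonelli is applied first to \<open>\<phi>\<close>, which is \<open>h\<close>
  minus an affine minorant and hence nonnegative; \<open>Z\<close> and \<open>h\<close> of
  \<open>Z\<close> are then controlled through \<open>\<phi>\<close>.\<close>

lemma integrable_pair_of_marginals:
  fixes h :: "real \<Rightarrow> real"
  assumes "prob_space U" "prob_space N"
    and Z [measurable]: "(\<lambda>(t, \<omega>). Z t \<omega>) \<in> borel_measurable (U \<Otimes>\<^sub>M N)"
    and law: "\<And>t. t \<in> space U \<Longrightarrow> distr N borel (Z t) = \<mu> t"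
    and h: "strictly_convex h" and [measurable]: "h \<in> borel_measurable borel"
    and id_int: "\<And>t. t \<in> space U \<Longrightarrow> integrable (\<mu> t) (\<lambda>x. x)"
    and h_int: "\<And>t. t \<in> space U \<Longrightarrow> integrable (\<mu> t) h"
    and first: "integrable U (\<lambda>t. \<integral>x. x \<partial>\<mu> t)"
    and second: "integrable U (\<lambda>t. \<integral>x. h x \<partial>\<mu> t)"
  shows "integrable (U \<Otimes>\<^sub>M N) (\<lambda>(t, \<omega>). Z t \<omega>)"
    and "integrable (U \<Otimes>\<^sub>M N) (\<lambda>(t, \<omega>). h (Z t \<omega>))"
    and "(\<integral>\<omega>. (\<integral>t. h (Z t \<omega>) \<partial>U) \<partial>N) = (\<integral>t. (\<integral>x. h x \<partial>\<mu> t) \<partial>U)"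
proof -
  interpret U: prob_space U by fact
  interpret N: prob_space N by fact
  interpret P: pair_prob_space U N ..
  obtain a b c where c: "c > 0" and dom: "\<And>x. c * \<bar>x\<bar> \<le> h x - b * x - a"
    using strictly_convex_coercive[OF h] by metis
  define \<phi> where "\<phi> x = h x - b * x - a" for x
  have [measurable]: "\<phi> \<in> borel_measurable borel"
    unfolding \<phi>_def by measurable
  have \<phi>_nonneg: "0 \<le> \<phi> x" for x
  proof -
    have "0 \<le> c * \<bar>x\<bar>"
      using c by simp
    then show ?thesis
      using dom[of x] by (simp add: \<phi>_def)
  qed
  have Zt [measurable]: "Z t \<in> borel_measurable N" if "t \<in> space U" for t
    using measurable_Pair2[OF Z that] by simp
  have prob_\<mu>: "prob_space (\<mu> t)" if "t \<in> space U" for t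
    using N.prob_space_distr[OF Zt[OF that]] law[OF that] by simp
  have int\<phi>: "integrable (\<mu> t) \<phi>" if "t \<in> space U" for t
  proof -
    interpret prob_space "\<mu> t" by (rule prob_\<mu>[OF that])
    show ?thesis
      unfolding \<phi>_def using id_int[OF that] h_int[OF that] by auto
  qed
  have mean\<phi>: "(\<integral>x. \<phi> x \<partial>\<mu> t) = (\<integral>x. h x \<partial>\<mu> t) - b * (\<integral>x. x \<partial>\<mu> t) - a"
    if "t \<in> space U" for t
  proof -
    interpret prob_space "\<mu> t" by (rule prob_\<mu>[OF that])
    show ?thesis
      unfolding \<phi>_def using id_int[OF that] h_int[OF that] by (simp add: prob_space)
  qed
  \<comment> \<open>Both moments are integrable by assumption, and the constant is integrable
    because \<open>U\<close> has total mass 1.\<close>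
  have "integrable U (\<lambda>t. (\<integral>x. h x \<partial>\<mu> t) - b * (\<integral>x. x \<partial>\<mu> t) - a)"
    using first second by auto
  then have mean\<phi>_int: "integrable U (\<lambda>t. \<integral>x. \<phi> x \<partial>\<mu> t)"
    by (rule Bochner_Integration.integrable_cong[THEN iffD1, rotated 2]) (simp_all add: mean\<phi>)
  have "(\<integral>\<^sup>+ w. ennreal (\<phi> (case w of (t, \<omega>) \<Rightarrow> Z t \<omega>)) \<partial>(U \<Otimes>\<^sub>M N)) =
      (\<integral>\<^sup>+ t. (\<integral>\<^sup>+ \<omega>. ennreal (\<phi> (Z t \<omega>)) \<partial>N) \<partial>U)"
    by (subst N.nn_integral_fst[symmetric]) auto
  also have "\<dots> = (\<integral>\<^sup>+ t. ennreal (\<integral>x. \<phi> x \<partial>\<mu> t) \<partial>U)"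
  proof (rule nn_integral_cong)
    fix t assume t: "t \<in> space U"
    have "(\<integral>\<^sup>+ \<omega>. ennreal (\<phi> (Z t \<omega>)) \<partial>N) = (\<integral>\<^sup>+ x. ennreal (\<phi> x) \<partial>\<mu> t)"
      using Zt[OF t] by (subst law[OF t, symmetric], subst nn_integral_distr) auto
    also have "\<dots> = ennreal (\<integral>x. \<phi> x \<partial>\<mu> t)"
      by (rule nn_integral_eq_integral[OF int\<phi>[OF t]]) (simp add: \<phi>_nonneg)
    finally show "(\<integral>\<^sup>+ \<omega>. ennreal (\<phi> (Z t \<omega>)) \<partial>N) = ennreal (\<integral>x. \<phi> x \<partial>\<mu> t)" .
  qed
  also have "\<dots> < \<infinity>"
    using nn_integral_eq_integral[OF mean\<phi>_int] by (simp add: \<phi>_nonneg)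
  finally have \<phi>Z: "integrable (U \<Otimes>\<^sub>M N) (\<lambda>w. \<phi> (case w of (t, \<omega>) \<Rightarrow> Z t \<omega>))"
    by (intro integrableI_nonneg) (auto simp: \<phi>_nonneg)
  \<comment> \<open>Coercivity is used here: \<open>\<bar>Z\<bar>\<close> is dominated by
    \<open>\<phi> / c\<close>.\<close>
  show intZ: "integrable (U \<Otimes>\<^sub>M N) (\<lambda>(t, \<omega>). Z t \<omega>)"
  proof (rule Bochner_Integration.integrable_bound)
    show "integrable (U \<Otimes>\<^sub>M N) (\<lambda>w. \<phi> (case w of (t, \<omega>) \<Rightarrow> Z t \<omega>) / c)"
      using \<phi>Z by simp
    show "AE w in U \<Otimes>\<^sub>M N. norm (case w of (t, \<omega>) \<Rightarrow> Z t \<omega>)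
        \<le> norm (\<phi> (case w of (t, \<omega>) \<Rightarrow> Z t \<omega>) / c)"
      using dom[folded \<phi>_def] c by (intro AE_I2) (auto simp: \<phi>_nonneg field_simps)
  qed simp
  have "integrable (U \<Otimes>\<^sub>M N) (\<lambda>w. \<phi> (case w of (t, \<omega>) \<Rightarrow> Z t \<omega>) +
      b * (case w of (t, \<omega>) \<Rightarrow> Z t \<omega>) + a)"
    using \<phi>Z intZ by auto
  also have "(\<lambda>w. \<phi> (case w of (t, \<omega>) \<Rightarrow> Z t \<omega>) + b * (case w of (t, \<omega>) \<Rightarrow> Z t \<omega>) + a) =
      (\<lambda>(t, \<omega>). h (Z t \<omega>))"
    by (auto simp: \<phi>_def)
  finally show inth: "integrable (U \<Otimes>\<^sub>M N) (\<lambda>(t, \<omega>). h (Z t \<omega>))" .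
  have "(\<integral>\<omega>. (\<integral>t. h (Z t \<omega>) \<partial>U) \<partial>N) = (\<integral>t. (\<integral>\<omega>. h (Z t \<omega>) \<partial>N) \<partial>U)"
    by (rule P.Fubini_integral[OF inth])
  also have "\<dots> = (\<integral>t. (\<integral>x. h x \<partial>\<mu> t) \<partial>U)"
  proof (rule Bochner_Integration.integral_cong[OF refl])
    fix t assume t: "t \<in> space U"
    show "(\<integral>\<omega>. h (Z t \<omega>) \<partial>N) = (\<integral>x. h x \<partial>\<mu> t)"
      using Zt[OF t] by (subst law[OF t, symmetric], subst integral_distr) auto
  qed
  finally show "(\<integral>\<omega>. (\<integral>t. h (Z t \<omega>) \<partial>U) \<partial>N) = (\<integral>t. (\<integral>x. h x \<partial>\<mu> t) \<partial>U)" .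
qed

text \<open>
  The affine minorant of \<open>h\<close> makes the left-hand integrand integrable, so that its integral is not
  the junk value \<open>0\<close>.
\<close>

lemma jensen_pair:
  fixes h :: "real \<Rightarrow> real"
  assumes "prob_space U" "prob_space N"
    and Z: "integrable (U \<Otimes>\<^sub>M N) (\<lambda>(t, \<omega>). Z t \<omega>)"
    and hZ: "integrable (U \<Otimes>\<^sub>M N) (\<lambda>(t, \<omega>). h (Z t \<omega>))"
    and h: "strictly_convex h" and [measurable]: "h \<in> borel_measurable borel"
  shows "(\<integral>\<omega>. h (\<integral>t. Z t \<omega> \<partial>U) \<partial>N) \<le> (\<integral>\<omega>. (\<integral>t. h (Z t \<omega>) \<partial>U) \<partial>N)"
proof -
  interpret U: prob_space U by fact
  interpret N: prob_space N by fact
  interpret P: pair_prob_space U N ..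
  obtain a b c where c: "c > 0" and dom: "\<And>x. c * \<bar>x\<bar> \<le> h x - b * x - a"
    using strictly_convex_coercive[OF h] by metis
  have lower: "b * x + a \<le> h x" for x
  proof -
    have "0 \<le> c * \<bar>x\<bar>"
      using c by simp
    then show ?thesis
      using dom[of x] by simp
  qed
  \<comment> \<open>Fubini gives integrable sections only for almost every \<omega>, so Jensen is
    available only almost everywhere.\<close>
  have AE_Z: "AE \<omega> in N. integrable U (\<lambda>t. Z t \<omega>)"
    using P.AE_integrable_snd[OF Z] by simp
  have AE_hZ: "AE \<omega> in N. integrable U (\<lambda>t. h (Z t \<omega>))"
    using P.AE_integrable_snd[OF hZ] by simp
  have jensen: "AE \<omega> in N. h (\<integral>t. Z t \<omega> \<partial>U) \<le> (\<integral>t. h (Z t \<omega>) \<partial>U)"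
    using AE_Z AE_hZ
  proof eventually_elim
    case (elim \<omega>)
    then show ?case
      by (intro U.jensens_inequality[where I = UNIV]) (auto intro: strictly_convex_imp_convex_on[OF h])
  qed
  have int1: "integrable N (\<lambda>\<omega>. \<integral>t. Z t \<omega> \<partial>U)"
    using P.integrable_snd[OF Z] by simp
  have int2: "integrable N (\<lambda>\<omega>. \<integral>t. h (Z t \<omega>) \<partial>U)"
    using P.integrable_snd[OF hZ] by simp
  \<comment> \<open>The integrand is squeezed between the affine minorant at the time average of
    \<open>Z\<close> and the upper bound from Jensen, both integrable.\<close>
  have "integrable N (\<lambda>\<omega>. h (\<integral>t. Z t \<omega> \<partial>U))"
  proof (rule Bochner_Integration.integrable_bound)
    show "integrable N (\<lambda>\<omega>. \<bar>\<integral>t. h (Z t \<omega>) \<partial>U\<bar> + \<bar>b * (\<integral>t. Z t \<omega> \<partial>U) + a\<bar>)"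
      using int1 int2 by auto
    show "(\<lambda>\<omega>. h (\<integral>t. Z t \<omega> \<partial>U)) \<in> borel_measurable N"
      using borel_measurable_integrable[OF int1] by measurable
    show "AE \<omega> in N. norm (h (\<integral>t. Z t \<omega> \<partial>U))
        \<le> norm (\<bar>\<integral>t. h (Z t \<omega>) \<partial>U\<bar> + \<bar>b * (\<integral>t. Z t \<omega> \<partial>U) + a\<bar>)"
      using jensen
    proof eventually_elim
      case (elim \<omega>)
      with lower[of "\<integral>t. Z t \<omega> \<partial>U"] show ?case
        by (simp add: abs_le_iff) linarith
    qed
  qed
  then show ?thesis
    using int2 jensen by (rule integral_mono_AE)
qed


section \<open>Comparison of \<open>X_opt\<close> with \<open>Y\<close>\<close>

theorem proposition4p1p2:
  fixes h :: "real \<Rightarrow> real"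
    and M :: "'a measure"
    and Y :: "real \<Rightarrow> 'a \<Rightarrow> real"
    and \<mu> :: "real \<Rightarrow> real measure"
  assumes "prob_space M"
    and Y_measurable: "(\<lambda>(t, \<omega>). Y t \<omega>) \<in> borel_measurable (restrict_space borel {0..1} \<Otimes>\<^sub>M M)"
    and Y_continuous: "\<forall>\<omega>\<in>space M. continuous_on {0..1} (\<lambda>t. Y t \<omega>)"
    and law: "\<forall>t\<in>{0..1}. \<mu> t = distr M borel (Y t)"
    and h_convex: "strictly_convex h"
    and h_C2: "twice_cont_diff h"
    and abs_cont: "\<forall>t\<in>{0..1}. absolutely_continuous lborel (\<mu> t)"
    and support: "\<forall>t\<in>{0..1}. \<exists>a b :: ereal. msupport (\<mu> t) = {x. a \<le> ereal x \<and> ereal x \<le> b}"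
    and weakly_cont: "weakly_continuous_path \<mu>"
    and moments_exist: "\<forall>t\<in>{0..1}. integrable (\<mu> t) (\<lambda>x. x) \<and> integrable (\<mu> t) h"
    and first_moments: "set_integrable lborel {0..1} (\<lambda>t. \<integral>x. x \<partial>\<mu> t)"
    and h_moments: "set_integrable lborel {0..1} (\<lambda>t. \<integral>x. h x \<partial>\<mu> t)"
    and riemann_sums: "\<forall>K. compact K \<longrightarrow> K \<subseteq> {0<..<1} \<longrightarrow>
       uniform_limit K
         (\<lambda>N l. (1 / real N) * (\<Sum>i=1..N. quantile \<mu> l (real i / real N)))
         (\<lambda>l. LINT t:{0..1}|lborel. quantile \<mu> l t)
         sequentially"
  shows "(\<integral>l. h (LINT t:{0..1}|lborel. X_opt \<mu> t l) \<partial>Opt_space)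
       \<le> (\<integral>\<omega>. (LINT t:{0..1}|lborel. h (Y t \<omega>)) \<partial>M)"
proof -
  define U :: "real measure" where "U = restrict_space lborel {0..1}"
  have space_U [simp]: "space U = {0..1}"
    by (simp add: U_def space_restrict_space)
  have integral_U: "(LINT t:{0..1}|lborel. f t) = (\<integral>t. f t \<partial>U)" for f :: "real \<Rightarrow> real"
    unfolding U_def set_lebesgue_integral_def by (subst integral_restrict_space) auto
  have integrable_U: "set_integrable lborel {0..1} f \<longleftrightarrow> integrable U f" for f :: "real \<Rightarrow> real"
    unfolding U_def set_integrable_def by (subst integrable_restrict_space) auto
  interpret M: prob_space M by fact
  have prob_U: "prob_space U"
    unfolding U_def by (rule prob_space_restrict_lborel_Icc)
  \<comment> \<open>The measurability assumption on \<open>Y\<close> uses the Borel trace on [0,1],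
    which has the same measurable sets as \<open>U\<close>.\<close>
  have "sets (restrict_space borel {0..1} \<Otimes>\<^sub>M M) = sets (U \<Otimes>\<^sub>M M)"
    unfolding U_def by (intro sets_pair_measure_cong sets_restrict_space_cong) simp_all
  with Y_measurable have Y [measurable]: "(\<lambda>(t, \<omega>). Y t \<omega>) \<in> borel_measurable (U \<Otimes>\<^sub>M M)"
    using measurable_cong_sets by blast
  have Yt: "Y t \<in> borel_measurable M" if "t \<in> space U" for t
    using measurable_Pair2[OF Y that] by simp
  have h_meas: "h \<in> borel_measurable borel"
  proof -
    obtain h' where "\<And>x. (h has_real_derivative h' x) (at x)"
      using h_C2 unfolding twice_cont_diff_def by blast
    then have "continuous_on UNIV h"
      by (meson DERIV_continuous_on has_field_derivative_at_within)
    then show ?thesis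
      by (rule borel_measurable_continuous_onI)
  qed
  have law': "distr M borel (Y t) = \<mu> t" if "t \<in> space U" for t
    using law that by simp
  have distr_\<mu>: "real_distribution (\<mu> t)" if "t \<in> space U" for t
    using M.real_distribution_distr[OF Yt[OF that]] law'[OF that] by simp
  \<comment> \<open>Measurability in \<open>t\<close> is inherited from \<open>Y\<close>: the
    distribution function at \<open>x\<close> is the measure of the \<open>t\<close>-section of the
    sublevel set \<open>Q\<close>.\<close>
  have cdf_meas: "(\<lambda>t. cdf (\<mu> t) x) \<in> borel_measurable U" for x
  proof -
    define Q where "Q = {w \<in> space (U \<Otimes>\<^sub>M M). (case w of (t, \<omega>) \<Rightarrow> Y t \<omega>) \<le> x}"
    have "Q \<in> sets (U \<Otimes>\<^sub>M M)"
      unfolding Q_def by measurable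
    then have "(\<lambda>t. measure M (Pair t -` Q)) \<in> borel_measurable U"
      unfolding measure_def using M.measurable_emeasure_Pair by measurable
    moreover have "cdf (\<mu> t) x = measure M (Pair t -` Q)" if t: "t \<in> space U" for t
    proof -
      have "cdf (\<mu> t) x = measure M (Y t -` {..x} \<inter> space M)"
        unfolding cdf_def law'[OF t, symmetric] using Yt[OF t] by (simp add: measure_distr)
      also have "Y t -` {..x} \<inter> space M = Pair t -` Q"
        using t by (auto simp: Q_def space_pair_measure)
      finally show ?thesis .
    qed
    ultimately show ?thesis
      by (subst measurable_cong) auto
  qed
  have X [measurable]: "(\<lambda>(t, l). X_opt \<mu> t l) \<in> borel_measurable (U \<Otimes>\<^sub>M Opt_space)"
    using abs_cont support by (intro measurable_X_opt distr_\<mu> cdf_meas) auto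
  have lawX: "distr Opt_space borel (X_opt \<mu> t) = \<mu> t" if t: "t \<in> space U" for t
  proof -
    obtain a b :: ereal where "msupport (\<mu> t) = {x. a \<le> ereal x \<and> ereal x \<le> b}"
      using support t unfolding space_U by blast
    then show ?thesis
      using measurable_Pair2[OF X t] abs_cont t by (intro distr_X_opt distr_\<mu>) auto
  qed
  note marginals = h_convex h_meas
    moments_exist[folded space_U, rule_format, THEN conjunct1]
    moments_exist[folded space_U, rule_format, THEN conjunct2]
    first_moments[unfolded integrable_U] h_moments[unfolded integrable_U]
  \<comment> \<open>The processes share the marginals \<open>\<mu>\<close>, so the third facts of
    \<open>intY\<close> and \<open>intX\<close> have the same right-hand side; this links the two
    probability spaces.\<close>
  note intY = integrable_pair_of_marginals[OF prob_U \<open>prob_space M\<close> Y law' marginals]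
  note intX = integrable_pair_of_marginals[OF prob_U prob_space_Opt_space X lawX marginals]
  have "(\<integral>l. h (\<integral>t. X_opt \<mu> t l \<partial>U) \<partial>Opt_space) \<le> (\<integral>l. (\<integral>t. h (X_opt \<mu> t l) \<partial>U) \<partial>Opt_space)"
    by (rule jensen_pair[OF prob_U prob_space_Opt_space intX(1,2) h_convex h_meas])
  also note intX(3)
  also note intY(3)[symmetric]
  finally show ?thesis
    unfolding integral_U .
qed

end
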